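(* Let $f=\sum_{p=1}^P f_p$ with $f_p:\mathbb{R}^n\to\mathbb{R}$ continuously differentiable for $p=1,\dots,P$. Assume that for every $w_0\in\mathbb{R}^n$ the level set $\mathcal{L}(w_0)=\{w\in\mathbb{R}^n: f(w)\le f(w_0)\}$ is compact, and that there exists $L>0$ such that $\|\nabla f_p(u)-\nabla f_p(v)\|\le L\|u-v\|$ for all $u,v\in\mathbb{R}^n$ and all $p=1,\dots,P$. Let $\{w^k\}$ be any sequence of points produced by Algorithm NMCMA (described in the context). Then $\{w^k\}$ admits limit points, and at least one limit point $\bar w$ of $\{w^k\}$ is stationary, i.e. $\nabla f(\bar w)=0$.
   Context: Norms are Euclidean. Inner_Cycle$(w,\zeta)$, for $w\in\mathbb{R}^n$, $\zeta>0$: choose a permutation $(h_1,\dots,h_P)$ of $\{1,\dots,P\}$ (arbitrary, possibly different at each call); set $\widetilde w_0=w$; for $i=1,\dots,P$ set $\widetilde d_i=-\nabla f_{h_i}(\widetilde w_{i-1})$ and $\widetilde w_i=\widetilde w_{i-1}+\zeta\widetilde d_i$. Return $(\widetilde w,d)$ with $\widetilde w=\widetilde w_P$ and $d=\sum_{i=1}^P\widetilde d_i$ (so $\widetilde w=w+\zeta d$). NMEDFL$(R,w,d,\zeta;\gamma,\delta)$ (Nonmonotone Extrapolation Derivative-Free Linesearch): set $\alpha=\zeta$. If $f(w+\alpha d)>R-\gamma\alpha^2\|d\|^2$, return $0$. Otherwise, while $f(w+(\alpha/\delta)d)\le\min\{R-\gamma(\alpha/\delta)^2\|d\|^2,\ f(w+\alpha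 d)\}$, replace $\alpha$ by $\alpha/\delta$; when the while loop stops return $\alpha$. Algorithm NMCMA: parameters $\zeta^0>0$, $\theta\in(0,1)$, $\tau>0$, $M\in\mathbb{N}$, $\gamma\in(0,1)$, $\delta\in(0,1)$, starting point $w^0\in\mathbb{R}^n$. For $k=0,1,2,\dots$: 1. Set $R^k=\max_{0\le j\le\min\{k,M\}} f(w^{k-j})$. 2. Compute $(\widetilde w^k,d^k)=$ Inner_Cycle$(w^k,\zeta^k)$. 3. If $f(\widetilde w^k)\le R^k-\gamma\max\{\zeta^k,\zeta^k\|d^k\|\}$: set $\alpha^k=\zeta^k$ and $\zeta^{k+1}=\zeta^k$. 4. Else, if $\|d^k\|\le\tau\zeta^k$: set $\zeta^{k+1}=\theta\zeta^k$ and $\alpha^k=0$. 5. Else, compute $\alpha^k=$ NMEDFL$(R^k,w^k,d^k,\zeta^k;\gamma,\delta)$; if $(\alpha^k)^2\|d^k\|^2\le\tau\zeta^k$ set $\zeta^{k+1}=\theta\zeta^k$, otherwise set $\zeta^{k+1}=\zeta^k$. 6. Set $w^{k+1}=w^k+\alpha^kd^k$. *)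

theory Defs
  imports "HOL-Analysis.Analysis" "HOL-Library.While_Combinator" "HOL-Combinatorics.Permutations"
begin

definition gradient :: "(real ^ 'n \<Rightarrow> real) \<Rightarrow> real ^ 'n \<Rightarrow> real ^ 'n"
  where "gradient f x = (THE D. GDERIV f x :> D)"

definition continuously_differentiable :: "(real ^ 'n \<Rightarrow> real) \<Rightarrow> bool"
  where "continuously_differentiable f \<longleftrightarrow>
    (\<forall>x. f differentiable (at x)) \<and> continuous_on UNIV (gradient f)"

text \<open>Limit points of a sequence are limits of subsequences (\<^const>\<open>islimpt\<close> on the range would
  lose the values that are attained infinitely often).\<close>

definition seq_limit_point :: "(nat \<Rightarrow> 'a::topological_space) \<Rightarrow> 'a \<Rightarrow> bool"
  where "seq_limit_point w x \<longleftrightarrow> (\<exists>r. strict_mono r \<and> (w \<circ> r) \<longlonglongrightarrow> x)"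

primrec inner_iterate ::
  "(nat \<Rightarrow> real ^ 'n \<Rightarrow> real) \<Rightarrow> (nat \<Rightarrow> nat) \<Rightarrow> real \<Rightarrow> real ^ 'n \<Rightarrow> nat \<Rightarrow> real ^ 'n"
  where
    "inner_iterate fs h \<zeta> w 0 = w"
  | "inner_iterate fs h \<zeta> w (Suc i) =
       inner_iterate fs h \<zeta> w i
         + \<zeta> *\<^sub>R (- gradient (fs (h (Suc i))) (inner_iterate fs h \<zeta> w i))"

text \<open>A relation rather than a function: every call may use a permutation of its own.\<close>

definition inner_cycle ::
  "(nat \<Rightarrow> real ^ 'n \<Rightarrow> real) \<Rightarrow> nat \<Rightarrow> real ^ 'n \<Rightarrow> real \<Rightarrow> real ^ 'n \<Rightarrow> real ^ 'n \<Rightarrow> bool"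
  where "inner_cycle fs P w \<zeta> wt d \<longleftrightarrow>
    (\<exists>h. h permutes {1..P} \<and>
         wt = inner_iterate fs h \<zeta> w P \<and>
         d = (\<Sum>i=1..P. - gradient (fs (h i)) (inner_iterate fs h \<zeta> w (i - 1))))"

text \<open>If the loop does not terminate, \<^const>\<open>while\<close> returns an unspecified value, so nothing
  about termination is assumed of the linesearch.\<close>

definition nmedfl ::
  "(real ^ 'n \<Rightarrow> real) \<Rightarrow> real \<Rightarrow> real ^ 'n \<Rightarrow> real ^ 'n \<Rightarrow> real \<Rightarrow> real \<Rightarrow> real \<Rightarrow> real"
  where "nmedfl f R w d \<zeta> \<gamma> \<delta> =
    (if f (w + \<zeta> *\<^sub>R d) > R - \<gamma> * \<zeta>\<^sup>2 * (norm d)\<^sup>2 then 0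
     else while
       (\<lambda>\<alpha>. f (w + (\<alpha> / \<delta>) *\<^sub>R d)
              \<le> min (R - \<gamma> * (\<alpha> / \<delta>)\<^sup>2 * (norm d)\<^sup>2) (f (w + \<alpha> *\<^sub>R d)))
       (\<lambda>\<alpha>. \<alpha> / \<delta>) \<zeta>)"

definition reference_value :: "(real ^ 'n \<Rightarrow> real) \<Rightarrow> nat \<Rightarrow> (nat \<Rightarrow> real ^ 'n) \<Rightarrow> nat \<Rightarrow> real"
  where "reference_value f M w k = Max ((\<lambda>j. f (w (k - j))) ` {0..min k M})"

definition nmcma_sequence ::
  "(nat \<Rightarrow> real ^ 'n \<Rightarrow> real) \<Rightarrow> nat \<Rightarrow> (real ^ 'n \<Rightarrow> real) \<Rightarrow>
    real \<Rightarrow> real \<Rightarrow> real \<Rightarrow> nat \<Rightarrow> real \<Rightarrow> real \<Rightarrow> real ^ 'n \<Rightarrow> (nat \<Rightarrow> real ^ 'n) \<Rightarrow> bool"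
  where "nmcma_sequence fs P f \<zeta>0 \<theta> \<tau> M \<gamma> \<delta> w0 w \<longleftrightarrow>
    (\<exists>\<zeta> \<alpha> wt d.
       w 0 = w0 \<and> \<zeta> 0 = \<zeta>0 \<and>
       (\<forall>k. let R = reference_value f M w k in
          inner_cycle fs P (w k) (\<zeta> k) (wt k) (d k) \<and>
          (if f (wt k) \<le> R - \<gamma> * max (\<zeta> k) (\<zeta> k * norm (d k)) then
             \<alpha> k = \<zeta> k \<and> \<zeta> (Suc k) = \<zeta> k
           else if norm (d k) \<le> \<tau> * \<zeta> k then
             \<alpha> k = 0 \<and> \<zeta> (Suc k) = \<theta> * \<zeta> k
           else
             \<alpha> k = nmedfl f R (w k) (d k) (\<zeta> k) \<gamma> \<delta> \<and>
             \<zeta> (Suc k) = (if (\<alpha> k)\<^sup>2 * (norm (d k))\<^sup>2 \<le> \<tau> * \<zeta> k then \<theta> * \<zeta> k else \<zeta> k)) \<and>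
          w (Suc k) = w k + \<alpha> k *\<^sub>R d k))"

end

theory Submission imports Defs begin

text \<open>If the stepsizes were bounded away from zero, they would be eventually constant, so every late
  step would decrease \<open>f\<close> below the reference value by a fixed amount; the reference value, a
  maximum over at most \<open>M + 1\<close> iterates, would then tend to minus infinity, although \<open>f\<close> is bounded
  below. Hence the stepsize is reduced infinitely often and tends to zero. A reduction at step \<open>k\<close>
  means that \<open>d\<^sup>k\<close> is small or that \<open>f\<close> decreases too little along \<open>d\<^sup>k\<close>. In the second case the
  mean value theorem and \<open>\<parallel>d\<^sup>k + \<nabla>f(w\<^sup>k)\<parallel> \<le> C \<zeta>\<^sup>k\<close> give a bound on \<open>\<parallel>d\<^sup>k\<parallel>\<close> that vanishes with
  \<open>\<zeta>\<^sup>k\<close>. So \<open>\<nabla>f(w\<^sup>k)\<close> tends to zero along the reduction steps, which all lie in a compact level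
  set.\<close>

section \<open>Gradients of real functions and of finite sums\<close>

lemma GDERIV_gradient:
  fixes f :: "real ^ 'n \<Rightarrow> real"
  assumes "GDERIV f x :> D"
  shows "gradient f x = D"
  unfolding gradient_def
proof (rule the_equality)
  fix E assume "GDERIV f x :> E"
  with assms have "(\<lambda>h. inner h D) = (\<lambda>h. inner h E)"
    unfolding gderiv_def by (rule has_derivative_unique)
  then have "inner (E - D) (E - D) = 0" by (simp add: inner_diff_right fun_eq_iff)
  then show "E = D" by simp
qed (fact assms)

text \<open>Riesz representation: the derivative \<open>f'\<close> is a linear functional, hence the
  inner product with \<open>adjoint f' 1\<close>. This shows that the description in
  \<open>gradient\<close> denotes something.\<close>

lemma differentiable_GDERIV:
  fixes f :: "real ^ 'n \<Rightarrow> real"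
  assumes "f differentiable (at x)"
  shows "GDERIV f x :> gradient f x"
proof -
  obtain f' where f': "(f has_derivative f') (at x)"
    using assms by (auto simp: differentiable_def)
  then have "linear f'" by (rule has_derivative_linear)
  then have "f' = (\<lambda>h. inner h (adjoint f' 1))"
    using adjoint_works[of f' _ 1] by (auto simp: fun_eq_iff)
  with f' have "GDERIV f x :> adjoint f' 1" by (simp add: gderiv_def)
  then show ?thesis by (simp add: GDERIV_gradient)
qed

lemma GDERIV_sum:
  fixes fs :: "nat \<Rightarrow> real ^ 'n \<Rightarrow> real"
  assumes "\<And>p. p \<in> A \<Longrightarrow> fs p differentiable (at x)"
  shows "GDERIV (\<lambda>x. \<Sum>p\<in>A. fs p x) x :> (\<Sum>p\<in>A. gradient (fs p) x)"
  using differentiable_GDERIV[OF assms] unfolding gderiv_def inner_sum_right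
  by (intro has_derivative_sum) auto

section \<open>Drift and gradient error of the inner cycle\<close>

text \<open>A discrete Gronwall estimate: the distance from \<open>w\<close> grows in one inner step
  by at most \<open>\<zeta> * (G + L * distance)\<close>. Using \<open>\<zeta> \<le> Z\<close> in
  the growth factor keeps one factor \<open>\<zeta>\<close> in front of a coefficient that depends
  on \<open>Z\<close> only.\<close>

lemma inner_iterate_dist:
  fixes fs :: "nat \<Rightarrow> real ^ 'n \<Rightarrow> real"
  assumes h: "h permutes {1..P}" and "0 \<le> \<zeta>" "\<zeta> \<le> Z" "0 \<le> L"
    and lip: "\<And>p u v. p \<in> {1..P} \<Longrightarrow>
           norm (gradient (fs p) u - gradient (fs p) v) \<le> L * norm (u - v)"
    and G: "\<And>p. p \<in> {1..P} \<Longrightarrow> norm (gradient (fs p) w) \<le> G" and "0 \<le> G"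
    and "i \<le> P"
  shows "norm (inner_iterate fs h \<zeta> w i - w) \<le> \<zeta> * (real i * G * (1 + L * Z) ^ i)"
  using \<open>i \<le> P\<close>
proof (induction i)
  case (Suc i)
  let ?x = "inner_iterate fs h \<zeta> w i" and ?q = "1 + L * Z"
  have p: "h (Suc i) \<in> {1..P}"
    using permutes_in_image[OF h, of "Suc i"] Suc.prems by simp
  have "norm (gradient (fs (h (Suc i))) ?x)
      \<le> norm (gradient (fs (h (Suc i))) w) + norm (gradient (fs (h (Suc i))) ?x - gradient (fs (h (Suc i))) w)"
    by (metis add.commute norm_triangle_sub)
  also have "\<dots> \<le> G + L * norm (?x - w)"
    using G[OF p] lip[OF p] by (intro add_mono)
  finally have g: "norm (gradient (fs (h (Suc i))) ?x) \<le> G + L * norm (?x - w)" .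
  have q: "1 \<le> ?q" using assms by simp
  have "norm (inner_iterate fs h \<zeta> w (Suc i) - w)
      \<le> norm (?x - w) + norm (\<zeta> *\<^sub>R gradient (fs (h (Suc i))) ?x)"
    using norm_triangle_ineq4[of "?x - w" "\<zeta> *\<^sub>R gradient (fs (h (Suc i))) ?x"]
    by (simp add: algebra_simps)
  also have "\<dots> \<le> norm (?x - w) + \<zeta> * (G + L * norm (?x - w))"
    using g \<open>0 \<le> \<zeta>\<close> by (simp add: mult_left_mono)
  also have "\<dots> = \<zeta> * G + (1 + L * \<zeta>) * norm (?x - w)" by (simp add: algebra_simps)
  also have "\<dots> \<le> \<zeta> * G + ?q * (\<zeta> * (real i * G * ?q ^ i))"
    using Suc q \<open>0 \<le> \<zeta>\<close> \<open>\<zeta> \<le> Z\<close> \<open>0 \<le> L\<close>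
    by (intro add_left_mono mult_mono) (auto intro: mult_left_mono)
  \<comment> \<open>A power of \<open>?q\<close>, at least 1, is inserted so that both summands
    carry \<open>?q ^ Suc i\<close>.\<close>
  also have "\<dots> \<le> \<zeta> * G * ?q ^ Suc i + ?q * (\<zeta> * (real i * G * ?q ^ i))"
    using one_le_power[OF q, of "Suc i"] \<open>0 \<le> \<zeta>\<close> \<open>0 \<le> G\<close>
    by (intro add_right_mono) (metis mult.right_neutral mult_left_mono mult_nonneg_nonneg)
  also have "\<dots> = \<zeta> * (real (Suc i) * G * ?q ^ Suc i)" by (simp add: algebra_simps)
  finally show ?case .
qed simp

lemma inner_iterate_eq_sum:
  "inner_iterate fs h \<zeta> w i
    = w + \<zeta> *\<^sub>R (\<Sum>j=1..i. - gradient (fs (h j)) (inner_iterate fs h \<zeta> w (j - 1)))"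
  by (induction i) (simp_all add: algebra_simps)

lemma inner_cycle_endpoint:
  assumes "inner_cycle fs P w \<zeta> wt d"
  shows "wt = w + \<zeta> *\<^sub>R d"
  using assms inner_iterate_eq_sum unfolding inner_cycle_def by blast

text \<open>The full sum of gradients at \<open>w\<close> is invariant under reordering, so the
  permutation of the cycle disappears. What remains, term by term, is the Lipschitz effect of the
  drift. The factor of \<open>\<zeta>\<close> is the same for all stepsizes up to \<open>Z\<close>
  and all permutations.\<close>

lemma inner_cycle_gradient_error:
  fixes fs :: "nat \<Rightarrow> real ^ 'n \<Rightarrow> real"
  assumes cyc: "inner_cycle fs P w \<zeta> wt d" and "0 \<le> \<zeta>" "\<zeta> \<le> Z" "0 \<le> L"
    and lip: "\<And>p u v. p \<in> {1..P} \<Longrightarrow>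
           norm (gradient (fs p) u - gradient (fs p) v) \<le> L * norm (u - v)"
    and G: "\<And>p. p \<in> {1..P} \<Longrightarrow> norm (gradient (fs p) w) \<le> G" and "0 \<le> G"
  shows "norm (d + (\<Sum>p=1..P. gradient (fs p) w))
    \<le> (\<Sum>i=1..P. L * (real (i - 1) * G * (1 + L * Z) ^ (i - 1))) * \<zeta>"
proof -
  obtain h where h: "h permutes {1..P}"
    and d: "d = (\<Sum>i=1..P. - gradient (fs (h i)) (inner_iterate fs h \<zeta> w (i - 1)))"
    using cyc by (auto simp: inner_cycle_def)
  have "(\<Sum>p=1..P. gradient (fs p) w) = (\<Sum>i=1..P. gradient (fs (h i)) w)"
    using sum.permute[OF h, of "\<lambda>p. gradient (fs p) w"] by (simp add: o_def)
  then have "d + (\<Sum>p=1..P. gradient (fs p) w)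
    = (\<Sum>i=1..P. gradient (fs (h i)) w - gradient (fs (h i)) (inner_iterate fs h \<zeta> w (i - 1)))"
    by (simp add: d sum_negf sum_subtractf)
  also have "norm \<dots> \<le> (\<Sum>i=1..P. L * (\<zeta> * (real (i - 1) * G * (1 + L * Z) ^ (i - 1))))"
  proof (rule sum_norm_le)
    fix i assume i: "i \<in> {1..P}"
    then have p: "h i \<in> {1..P}" using permutes_in_image[OF h] by simp
    have "norm (inner_iterate fs h \<zeta> w (i - 1) - w)
        \<le> \<zeta> * (real (i - 1) * G * (1 + L * Z) ^ (i - 1))"
      using i by (intro inner_iterate_dist[OF h assms(2,3,4) lip G \<open>0 \<le> G\<close>]) auto
    then show "norm (gradient (fs (h i)) w - gradient (fs (h i)) (inner_iterate fs h \<zeta> w (i - 1)))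
        \<le> L * (\<zeta> * (real (i - 1) * G * (1 + L * Z) ^ (i - 1)))"
      using lip[OF p, of w "inner_iterate fs h \<zeta> w (i - 1)"] \<open>0 \<le> L\<close>
      by (smt (verit) mult_left_mono norm_minus_commute)
  qed
  also have "\<dots> = (\<Sum>i=1..P. L * (real (i - 1) * G * (1 + L * Z) ^ (i - 1))) * \<zeta>"
    by (simp add: sum_distrib_left sum_distrib_right algebra_simps)
  finally show ?thesis .
qed

section \<open>Linesearch: termination and consequences of insufficient decrease\<close>

text \<open>The value of \<open>while\<close> is known only once termination is proved. Each
  accepted trial stepsize has its square bounded because \<open>f\<close> is bounded below and
  \<open>d\<close> is nonzero, whereas extrapolation enlarges it geometrically. On exit the
  acceptance test still holds and the loop guard fails.\<close>

lemma nmedfl_cases: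
  fixes f :: "real ^ 'n \<Rightarrow> real"
  assumes bdd: "\<And>x. m \<le> f x" and "d \<noteq> 0" "0 < \<zeta>" "0 < \<gamma>" "0 < \<delta>" "\<delta> < 1"
  obtains
    (fail) "nmedfl f R w d \<zeta> \<gamma> \<delta> = 0" "f (w + \<zeta> *\<^sub>R d) > R - \<gamma> * \<zeta>\<^sup>2 * (norm d)\<^sup>2"
  | (step) a where "nmedfl f R w d \<zeta> \<gamma> \<delta> = a" "\<zeta> \<le> a" "f (w + a *\<^sub>R d) \<le> R - \<gamma> * a\<^sup>2 * (norm d)\<^sup>2"
      "f (w + (a / \<delta>) *\<^sub>R d) > min (R - \<gamma> * (a / \<delta>)\<^sup>2 * (norm d)\<^sup>2) (f (w + a *\<^sub>R d))"
proof (cases "f (w + \<zeta> *\<^sub>R d) > R - \<gamma> * \<zeta>\<^sup>2 * (norm d)\<^sup>2")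
  case True
  then show ?thesis using fail by (simp add: nmedfl_def)
next
  case False
  let ?b = "\<lambda>\<alpha>. f (w + (\<alpha> / \<delta>) *\<^sub>R d)
              \<le> min (R - \<gamma> * (\<alpha> / \<delta>)\<^sup>2 * (norm d)\<^sup>2) (f (w + \<alpha> *\<^sub>R d))"
  let ?I = "\<lambda>\<alpha>. \<zeta> \<le> \<alpha> \<and> f (w + \<alpha> *\<^sub>R d) \<le> R - \<gamma> * \<alpha>\<^sup>2 * (norm d)\<^sup>2"
  let ?Q = "\<lambda>a. ?I a \<and> \<not> ?b a"
  \<comment> \<open>Acceptance of \<open>\<alpha>\<close> at a value at least \<open>m\<close> gives
    \<open>\<gamma> * \<alpha>\<^sup>2 * (norm d)\<^sup>2 \<le> R - m\<close>; \<open>A\<close> is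
    this solved for \<open>\<alpha>\<close>. The increment
    \<open>\<alpha> * (1 / \<delta> - 1)\<close> is least at \<open>\<alpha> = \<zeta>\<close>,
    where it is \<open>\<eta>\<close>.\<close>
  define A where "A = sqrt ((R - m) / (\<gamma> * (norm d)\<^sup>2))"
  define \<eta> where "\<eta> = \<zeta> * (1 / \<delta> - 1)"
  have "0 < \<eta>" using assms by (simp add: \<eta>_def)
  have A: "\<alpha> \<le> A" if "?I \<alpha>" for \<alpha>
  proof -
    have "\<gamma> * \<alpha>\<^sup>2 * (norm d)\<^sup>2 \<le> R - m" using that bdd[of "w + \<alpha> *\<^sub>R d"] by linarith
    then have "\<alpha>\<^sup>2 \<le> (R - m) / (\<gamma> * (norm d)\<^sup>2)"
      using assms by (simp add: pos_le_divide_eq algebra_simps)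
    then show ?thesis unfolding A_def by (rule real_le_rsqrt)
  qed
  \<comment> \<open>The trial stepsizes are bounded by \<open>A\<close> and grow by at least \<open>\<eta>\<close> in each round.\<close>
  have "?Q (while ?b (\<lambda>\<alpha>. \<alpha> / \<delta>) \<zeta>)"
  proof (rule while_rule[where P = ?I and r = "Wellfounded.measure (\<lambda>\<alpha>. nat \<lceil>(A - \<alpha>) / \<eta>\<rceil>)"])
    show "?I \<zeta>" using False by simp
  next
    fix \<alpha> assume I: "?I \<alpha>" and b: "?b \<alpha>"
    have le: "\<alpha> \<le> \<alpha> / \<delta>" using I assms by (simp add: pos_le_divide_eq mult_left_le)
    then show I': "?I (\<alpha> / \<delta>)" using I b by simp
    have "\<zeta> * (1 / \<delta> - 1) \<le> \<alpha> * (1 / \<delta> - 1)"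
      using I assms by (intro mult_right_mono) auto
    then have "\<alpha> + \<eta> \<le> \<alpha> / \<delta>" by (simp add: \<eta>_def algebra_simps)
    then have "(A - \<alpha> / \<delta>) / \<eta> \<le> (A - \<alpha> - \<eta>) / \<eta>"
      using \<open>0 < \<eta>\<close> by (intro divide_right_mono) auto
    then have "(A - \<alpha> / \<delta>) / \<eta> \<le> (A - \<alpha>) / \<eta> - 1"
      using \<open>0 < \<eta>\<close> by (simp add: diff_divide_distrib)
    \<comment> \<open>Nonnegativity makes the decrease strict after \<open>nat\<close>, which would
      truncate negative ceilings to zero.\<close>
    moreover have "0 \<le> (A - \<alpha> / \<delta>) / \<eta>" using A[OF I'] \<open>0 < \<eta>\<close> by simp
    ultimately have "nat \<lceil>(A - \<alpha> / \<delta>) / \<eta>\<rceil> < nat \<lceil>(A - \<alpha>) / \<eta>\<rceil>" by linarith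
    then show "(\<alpha> / \<delta>, \<alpha>) \<in> Wellfounded.measure (\<lambda>\<alpha>. nat \<lceil>(A - \<alpha>) / \<eta>\<rceil>)" by simp
  qed simp_all
  moreover have "nmedfl f R w d \<zeta> \<gamma> \<delta> = while ?b (\<lambda>\<alpha>. \<alpha> / \<delta>) \<zeta>"
    using False by (simp add: nmedfl_def)
  ultimately show ?thesis using step by force
qed

text \<open>By the mean value theorem the slope along \<open>d\<close> at some \<open>s\<close> in
  between exceeds \<open>- c * b * (norm d)\<^sup>2\<close>. Moving the gradient back to
  \<open>w\<close> costs \<open>\<Lambda> * b * norm d\<close>, and replacing \<open>g w\<close> by
  \<open>- d\<close> costs \<open>e\<close>, each times \<open>norm d\<close>; dividing by
  \<open>norm d\<close> gives the bound. The product \<open>(b - a) * b\<close> in the hypothesis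
  lets \<open>b - a\<close> cancel and becomes the square \<open>b\<^sup>2\<close> for
  \<open>a = 0\<close>.\<close>

lemma insufficient_decrease_direction_bound:
  fixes f :: "real ^ 'n \<Rightarrow> real"
  assumes deriv: "\<And>x. GDERIV f x :> g x"
    and lip: "\<And>u v. norm (g u - g v) \<le> \<Lambda> * norm (u - v)" and "0 \<le> \<Lambda>"
    and err: "norm (d + g w) \<le> e" and "0 \<le> a" "a < b"
    and ins: "f (w + b *\<^sub>R d) > f (w + a *\<^sub>R d) - c * (b - a) * b * (norm d)\<^sup>2"
  shows "norm d \<le> e + (\<Lambda> + c) * (b * norm d)"
proof (cases "d = 0")
  case True
  moreover have "0 \<le> e" using err norm_ge_zero order_trans by blast
  ultimately show ?thesis by simp
next
  case False
  have "((\<lambda>t. f (w + t *\<^sub>R d)) has_real_derivative inner d (g (w + t *\<^sub>R d))) (at t)" for t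
  proof -
    have "((\<lambda>t. f (w + t *\<^sub>R d)) has_derivative (\<lambda>h. inner (h *\<^sub>R d) (g (w + t *\<^sub>R d)))) (at t)"
      using deriv[of "w + t *\<^sub>R d"] unfolding gderiv_def
      by (rule has_derivative_compose[rotated]) (auto intro!: derivative_eq_intros)
    then show ?thesis by (simp add: has_field_derivative_def mult_commute_abs)
  qed
  from MVT2[OF \<open>a < b\<close> this] obtain s where s: "a < s" "s < b"
    and eq: "f (w + b *\<^sub>R d) - f (w + a *\<^sub>R d) = (b - a) * inner d (g (w + s *\<^sub>R d))" by blast
  have "0 < (b - a) * (inner d (g (w + s *\<^sub>R d)) + c * b * (norm d)\<^sup>2)"
    using ins eq by (simp add: algebra_simps)
  then have pos: "0 < inner d (g (w + s *\<^sub>R d)) + c * b * (norm d)\<^sup>2"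
    using \<open>a < b\<close> by (simp add: zero_less_mult_iff)
  have "inner d (g (w + s *\<^sub>R d)) = inner d (g (w + s *\<^sub>R d) - g w) + inner d (d + g w) - (norm d)\<^sup>2"
    by (simp add: inner_diff_right inner_add_right power2_norm_eq_inner)
  also have "\<dots> \<le> norm d * (\<Lambda> * (b * norm d)) + norm d * e - (norm d)\<^sup>2"
  proof (intro diff_right_mono add_mono)
    have "norm (g (w + s *\<^sub>R d) - g w) \<le> \<Lambda> * norm (s *\<^sub>R d)" using lip[of "w + s *\<^sub>R d" w] by simp
    also have "\<dots> \<le> \<Lambda> * (b * norm d)"
      using s \<open>0 \<le> a\<close> \<open>0 \<le> \<Lambda>\<close> by (auto intro!: mult_left_mono mult_right_mono)
    finally show "inner d (g (w + s *\<^sub>R d) - g w) \<le> norm d * (\<Lambda> * (b * norm d))"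
      by (meson mult_left_mono norm_cauchy_schwarz norm_ge_zero order_trans)
    show "inner d (d + g w) \<le> norm d * e"
      using err by (meson mult_left_mono norm_cauchy_schwarz norm_ge_zero order_trans)
  qed
  finally have "0 < norm d * (e + (\<Lambda> + c) * (b * norm d) - norm d)"
    using pos by (simp add: algebra_simps power2_eq_square)
  then show ?thesis by (simp add: zero_less_mult_iff)
qed

section \<open>Nonmonotone reference values\<close>

lemma le_reference_value:
  assumes "j \<le> min k M"
  shows "f (w (k - j)) \<le> reference_value f M w k"
  unfolding reference_value_def using assms by (intro Max_ge) auto

lemma reference_value_leI:
  assumes "\<And>j. j \<le> min k M \<Longrightarrow> f (w (k - j)) \<le> B"
  shows "reference_value f M w k \<le> B"
  unfolding reference_value_def using assms by (subst Max_le_iff) auto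

lemma reference_value_antimono:
  assumes "\<And>k. f (w (Suc k)) \<le> reference_value f M w k" and "i \<le> k"
  shows "reference_value f M w k \<le> reference_value f M w i"
proof -
  have "reference_value f M w (Suc n) \<le> reference_value f M w n" for n
  proof (rule reference_value_leI)
    fix j assume "j \<le> min (Suc n) M"
    \<comment> \<open>Offset 0 is the new iterate; any other offset \<open>j\<close> is offset
      \<open>j - 1\<close> of the previous window.\<close>
    then show "f (w (Suc n - j)) \<le> reference_value f M w n"
      using assms(1)[of n] le_reference_value[of "j - 1" n M f w] by (cases j) auto
  qed
  then show ?thesis using \<open>i \<le> k\<close> by (rule lift_Suc_antimono_le)
qed

text \<open>After \<open>Suc M\<close> steps the window has been completely renewed: each of its
  iterates was produced after the block began and lies at least \<open>c\<close> below the reference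
  value at that time.\<close>

lemma reference_value_decrease:
  assumes mono: "\<And>k. f (w (Suc k)) \<le> reference_value f M w k"
    and dec: "\<And>k. K \<le> k \<Longrightarrow> f (w (Suc k)) \<le> reference_value f M w k - c"
  shows "reference_value f M w (K + n * Suc M) \<le> reference_value f M w K - real n * c"
proof (induction n)
  case (Suc n)
  let ?k = "K + n * Suc M"
  have "reference_value f M w (?k + Suc M) \<le> reference_value f M w ?k - c"
  proof (rule reference_value_leI)
    fix j assume "j \<le> min (?k + Suc M) M"
    then have j: "?k + Suc M - j = Suc (?k + (M - j))" by simp
    have "f (w (Suc (?k + (M - j)))) \<le> reference_value f M w (?k + (M - j)) - c"
      by (rule dec) simp
    also have "\<dots> \<le> reference_value f M w ?k - c"
      using reference_value_antimono[of f w M, OF mono, of ?k "?k + (M - j)"] by simp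
    finally show "f (w (?k + Suc M - j)) \<le> reference_value f M w ?k - c" by (simp only: j)
  qed
  with Suc show ?case by (simp add: algebra_simps)
qed simp

lemma bounded_below_no_uniform_decrease:
  assumes bdd: "\<And>x. m \<le> f x"
    and mono: "\<And>k. f (w (Suc k)) \<le> reference_value f M w k"
    and dec: "\<And>k. K \<le> k \<Longrightarrow> f (w (Suc k)) \<le> reference_value f M w k - c"
  shows "c \<le> 0"
proof (rule ccontr)
  assume "\<not> c \<le> 0"
  then obtain n where n: "reference_value f M w K - m < real n * c"
    using reals_Archimedean3[of c] by auto
  \<comment> \<open>The index ends in \<open>- 0\<close> to match the offset form of
    \<open>le_reference_value\<close>.\<close>
  have "m \<le> f (w (K + n * Suc M - 0))" by (rule bdd)
  also have "\<dots> \<le> reference_value f M w (K + n * Suc M)" by (rule le_reference_value) simp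
  also have "\<dots> \<le> reference_value f M w K - real n * c"
    by (rule reference_value_decrease[OF mono dec])
  finally show False using n by linarith
qed

section \<open>Vanishing stepsizes and a lower bound for the objective\<close>

text \<open>The monotone sequence has a limit \<open>l\<close>; passing to the limit along the
  reduction indices gives \<open>l = \<theta> * l\<close>.\<close>

lemma geometric_reduction_tendsto_zero:
  fixes \<zeta> :: "nat \<Rightarrow> real"
  assumes pos: "\<And>k. 0 \<le> \<zeta> k" and dec: "\<And>k. \<zeta> (Suc k) \<le> \<zeta> k" and "\<theta> < 1"
    and inf: "infinite {k. \<zeta> (Suc k) = \<theta> * \<zeta> k}"
  shows "\<zeta> \<longlonglongrightarrow> 0"
proof -
  obtain l where l: "\<zeta> \<longlonglongrightarrow> l"
    using decseq_convergent[of \<zeta> 0] pos dec by (metis decseq_SucI)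
  let ?r = "enumerate {k. \<zeta> (Suc k) = \<theta> * \<zeta> k}"
  have r: "strict_mono ?r" using inf by (rule strict_mono_enumerate)
  have "(\<lambda>n. \<zeta> (Suc (?r n))) \<longlonglongrightarrow> l"
    using LIMSEQ_subseq_LIMSEQ[OF LIMSEQ_Suc[OF l] r] by (simp add: o_def)
  moreover have "\<zeta> (Suc (?r n)) = \<theta> * \<zeta> (?r n)" for n
    using enumerate_in_set[OF inf, of n] by simp
  ultimately have "(\<lambda>n. \<theta> * \<zeta> (?r n)) \<longlonglongrightarrow> l" by simp
  moreover have "(\<lambda>n. \<theta> * \<zeta> (?r n)) \<longlonglongrightarrow> \<theta> * l"
    using LIMSEQ_subseq_LIMSEQ[OF l r] by (auto simp: o_def intro: tendsto_mult_left)
  ultimately have "l = \<theta> * l" by (rule LIMSEQ_unique)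
  with \<open>\<theta> < 1\<close> l show ?thesis by auto
qed

text \<open>A minimum over the level set of the origin is global, since outside this set
  \<open>f\<close> exceeds \<open>f 0\<close>.\<close>

lemma compact_level_sets_bounded_below:
  fixes f :: "real ^ 'n \<Rightarrow> real"
  assumes "\<And>v. compact {u. f u \<le> f v}" and "continuous_on UNIV f"
  obtains m where "\<And>x. m \<le> f x"
proof -
  have "\<exists>x\<in>{u. f u \<le> f 0}. \<forall>y\<in>{u. f u \<le> f 0}. f x \<le> f y"
    using assms by (intro continuous_attains_inf) (auto intro: continuous_on_subset)
  then show ?thesis using that by (metis linear mem_Collect_eq order_trans)
qed


section \<open>Case analysis of one iteration\<close>

text \<open>All ways in which the linesearch can lead to a stepsize reduction are covered by the single case
  \<open>stalled\<close>: no step at all (\<open>a = 0\<close>, \<open>b = \<zeta>\<close>), or an extrapolation that stopped because of the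
  reference value (\<open>a = 0\<close>, \<open>b = \<alpha> / \<delta>\<close>) or because of the previous trial point
  (\<open>a = \<alpha>\<close>, \<open>b = \<alpha> / \<delta>\<close>).\<close>

lemma nmcma_step_cases:
  fixes f :: "real ^ 'n \<Rightarrow> real"
  assumes bdd: "\<And>x. m \<le> f x" and pos: "0 < \<zeta>" "0 < \<tau>" "0 < \<gamma>" "0 < \<delta>" "\<delta> < 1"
    and R: "f x \<le> R"
    and step: "if f (x + \<zeta> *\<^sub>R d) \<le> R - \<gamma> * max \<zeta> (\<zeta> * norm d) then \<alpha> = \<zeta> \<and> \<zeta>' = \<zeta>
       else if norm d \<le> \<tau> * \<zeta> then \<alpha> = 0 \<and> \<zeta>' = \<theta> * \<zeta>
       else \<alpha> = nmedfl f R x d \<zeta> \<gamma> \<delta> \<and>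
         \<zeta>' = (if \<alpha>\<^sup>2 * (norm d)\<^sup>2 \<le> \<tau> * \<zeta> then \<theta> * \<zeta> else \<zeta>)"
  obtains
    (progress) "\<zeta>' = \<zeta>" "f (x + \<alpha> *\<^sub>R d) \<le> R - \<gamma> * min 1 \<tau> * \<zeta>"
  | (small) "\<zeta>' = \<theta> * \<zeta>" "f (x + \<alpha> *\<^sub>R d) \<le> R" "norm d \<le> \<tau> * \<zeta>"
  | (stalled) a b where "\<zeta>' = \<theta> * \<zeta>" "f (x + \<alpha> *\<^sub>R d) \<le> R" "0 \<le> a" "a < b"
      "b * norm d \<le> max (\<zeta> * norm d) (sqrt (\<tau> * \<zeta>) / \<delta>)"
      "f (x + b *\<^sub>R d) > f (x + a *\<^sub>R d) - \<gamma> * (b - a) * b * (norm d)\<^sup>2"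
proof (cases "f (x + \<zeta> *\<^sub>R d) \<le> R - \<gamma> * max \<zeta> (\<zeta> * norm d)")
  case True
  \<comment> \<open>An accepted cycle gains \<open>\<gamma> * \<zeta>\<close>, an extrapolation
    without reduction \<open>\<gamma> * \<tau> * \<zeta>\<close>; the factor
    \<open>min 1 \<tau>\<close> serves both.\<close>
  have "min 1 \<tau> * \<zeta> \<le> 1 * \<zeta>" using pos by (intro mult_right_mono) auto
  then have "min 1 \<tau> * \<zeta> \<le> max \<zeta> (\<zeta> * norm d)" by linarith
  then have "\<gamma> * (min 1 \<tau> * \<zeta>) \<le> \<gamma> * max \<zeta> (\<zeta> * norm d)"
    using pos by (intro mult_left_mono) simp_all
  then show ?thesis using True step by (intro progress) (auto simp: mult.assoc)
next
  case not_accepted: False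
  show ?thesis
  proof (cases "norm d \<le> \<tau> * \<zeta>")
    case True
    then show ?thesis using not_accepted step R by (intro small) auto
  next
    case False
    then have \<alpha>: "\<alpha> = nmedfl f R x d \<zeta> \<gamma> \<delta>"
      and \<zeta>': "\<zeta>' = (if \<alpha>\<^sup>2 * (norm d)\<^sup>2 \<le> \<tau> * \<zeta> then \<theta> * \<zeta> else \<zeta>)"
      using not_accepted step by auto
    have "d \<noteq> 0" using False pos by auto
    from bdd this \<open>0 < \<zeta>\<close> \<open>0 < \<gamma>\<close> \<open>0 < \<delta>\<close> \<open>\<delta> < 1\<close> show ?thesis
    proof (cases rule: nmedfl_cases[where f = f and w = x and R = R])
      case fail
      then have "f (x + \<zeta> *\<^sub>R d) > f x - \<gamma> * (\<zeta> - 0) * \<zeta> * (norm d)\<^sup>2"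
        using R by (simp add: power2_eq_square mult.assoc)
      then show ?thesis using fail \<alpha> \<zeta>' R pos by (intro stalled[of 0 \<zeta>]) auto
    next
      case (step a)
      have "0 < a" using step pos by linarith
      then have "a < a / \<delta>" using pos by (simp add: pos_less_divide_eq)
      have dec: "f (x + \<alpha> *\<^sub>R d) \<le> R - \<gamma> * (\<alpha>\<^sup>2 * (norm d)\<^sup>2)" using step \<alpha> by (simp add: mult.assoc)
      show ?thesis
      proof (cases "\<alpha>\<^sup>2 * (norm d)\<^sup>2 \<le> \<tau> * \<zeta>")
        case True
        have fR: "f (x + \<alpha> *\<^sub>R d) \<le> R" using dec pos
          by (smt (verit) mult_nonneg_nonneg zero_le_power2)
        \<comment> \<open>The test that triggers the reduction bounds the accepted displacement; the
          rejected trial is longer by the factor \<open>1 / \<delta>\<close>.\<close>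
        have "a * norm d \<le> sqrt (\<tau> * \<zeta>)"
          using True step \<alpha> by (intro real_le_rsqrt) (simp add: power_mult_distrib)
        then have b: "a / \<delta> * norm d \<le> max (\<zeta> * norm d) (sqrt (\<tau> * \<zeta>) / \<delta>)"
          using pos by (simp add: divide_right_mono le_max_iff_disj)
        have "R - \<gamma> * (a / \<delta>)\<^sup>2 * (norm d)\<^sup>2 < f (x + (a / \<delta>) *\<^sub>R d) \<or> f (x + a *\<^sub>R d) < f (x + (a / \<delta>) *\<^sub>R d)"
          using step by (simp add: min_less_iff_disj)
        then show ?thesis
        proof
          assume "R - \<gamma> * (a / \<delta>)\<^sup>2 * (norm d)\<^sup>2 < f (x + (a / \<delta>) *\<^sub>R d)"
          then have "f (x + (a / \<delta>) *\<^sub>R d) > f (x + 0 *\<^sub>R d) - \<gamma> * (a / \<delta> - 0) * (a / \<delta>) * (norm d)\<^sup>2"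
            using R by (simp add: power2_eq_square mult.assoc)
          then show ?thesis using \<zeta>' True fR b \<open>0 < a\<close> pos by (intro stalled[of 0 "a / \<delta>"]) auto
        next
          assume "f (x + a *\<^sub>R d) < f (x + (a / \<delta>) *\<^sub>R d)"
          \<comment> \<open>An actual increase from \<open>a\<close> to \<open>a / \<delta>\<close>
            is stronger than insufficient decrease, as the subtracted term is nonnegative.\<close>
          moreover have "0 \<le> \<gamma> * (a / \<delta> - a) * (a / \<delta>) * (norm d)\<^sup>2"
            using \<open>0 < a\<close> \<open>a < a / \<delta>\<close> pos by (intro mult_nonneg_nonneg) auto
          ultimately show ?thesis
            using \<zeta>' True fR b \<open>0 < a\<close> \<open>a < a / \<delta>\<close> by (intro stalled[of a "a / \<delta>"]) auto
        qed
      next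
        case False
        have "min 1 \<tau> * \<zeta> \<le> \<tau> * \<zeta>" using pos by (intro mult_right_mono) auto
        also have "\<dots> \<le> \<alpha>\<^sup>2 * (norm d)\<^sup>2" using False by simp
        finally have "\<gamma> * (min 1 \<tau> * \<zeta>) \<le> \<gamma> * (\<alpha>\<^sup>2 * (norm d)\<^sup>2)"
          using pos by (intro mult_left_mono) auto
        then show ?thesis using False \<zeta>' dec by (intro progress) (auto simp: mult.assoc)
      qed
    qed
  qed
qed

section \<open>Convergence along the stepsize reductions\<close>

theorem proposition12:
  fixes fs :: "nat \<Rightarrow> real ^ 'n \<Rightarrow> real" and f :: "real ^ 'n \<Rightarrow> real"
    and P M :: nat and L \<zeta>0 \<theta> \<tau> \<gamma> \<delta> :: real
    and w0 :: "real ^ 'n" and w :: "nat \<Rightarrow> real ^ 'n"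
  assumes "f = (\<lambda>x. \<Sum>p=1..P. fs p x)"
    and "\<And>p. p \<in> {1..P} \<Longrightarrow> continuously_differentiable (fs p)"
    and "\<And>v. compact {u. f u \<le> f v}"
    and "L > 0"
    and "\<And>p u v. p \<in> {1..P} \<Longrightarrow>
           norm (gradient (fs p) u - gradient (fs p) v) \<le> L * norm (u - v)"
    and "\<zeta>0 > 0" and "\<theta> \<in> {0<..<1}" and "\<tau> > 0" and "\<gamma> \<in> {0<..<1}" and "\<delta> \<in> {0<..<1}"
    and "nmcma_sequence fs P f \<zeta>0 \<theta> \<tau> M \<gamma> \<delta> w0 w"
  shows "(\<exists>x. seq_limit_point w x) \<and> (\<exists>x. seq_limit_point w x \<and> gradient f x = 0)"
proof -
  note lip = assms(5)
  have pos: "0 < \<theta>" "\<theta> < 1" "0 < \<tau>" "0 < \<gamma>" "0 < \<delta>" "\<delta> < 1" using assms by auto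
  define g where "g = (\<lambda>x. \<Sum>p=1..P. gradient (fs p) x)"
  define \<Lambda> where "\<Lambda> = real P * L"
  have "0 \<le> \<Lambda>" using \<open>L > 0\<close> by (simp add: \<Lambda>_def)
  have deriv: "GDERIV f x :> g x" for x
    unfolding assms(1) g_def
    using assms(2) by (intro GDERIV_sum) (auto simp: continuously_differentiable_def)
  have lip_g: "norm (g u - g v) \<le> \<Lambda> * norm (u - v)" for u v
  proof -
    have "norm (g u - g v) \<le> (\<Sum>p=1..P. L * norm (u - v))"
      unfolding g_def sum_subtractf[symmetric] by (intro sum_norm_le lip) auto
    then show ?thesis by (simp add: \<Lambda>_def)
  qed
  have cont_f: "continuous_on UNIV f"
    using deriv by (meson gderiv_def has_derivative_continuous continuous_at_imp_continuous_on)
  have cont_fs: "continuous_on UNIV (gradient (fs p))" if "p \<in> {1..P}" for p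
    using assms(2)[OF that] by (simp add: continuously_differentiable_def)
  have cont_g: "continuous_on UNIV g" unfolding g_def by (intro continuous_on_sum cont_fs)
  obtain m where bdd: "\<And>x. m \<le> f x"
    using compact_level_sets_bounded_below[OF assms(3) cont_f] by blast

  obtain \<zeta> \<alpha> wt d where "w 0 = w0" "\<zeta> 0 = \<zeta>0"
    and run: "\<forall>k. inner_cycle fs P (w k) (\<zeta> k) (wt k) (d k) \<and>
          (if f (wt k) \<le> reference_value f M w k - \<gamma> * max (\<zeta> k) (\<zeta> k * norm (d k)) then
             \<alpha> k = \<zeta> k \<and> \<zeta> (Suc k) = \<zeta> k
           else if norm (d k) \<le> \<tau> * \<zeta> k then
             \<alpha> k = 0 \<and> \<zeta> (Suc k) = \<theta> * \<zeta> k
           else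
             \<alpha> k = nmedfl f (reference_value f M w k) (w k) (d k) (\<zeta> k) \<gamma> \<delta> \<and>
             \<zeta> (Suc k) = (if (\<alpha> k)\<^sup>2 * (norm (d k))\<^sup>2 \<le> \<tau> * \<zeta> k then \<theta> * \<zeta> k else \<zeta> k)) \<and>
          w (Suc k) = w k + \<alpha> k *\<^sub>R d k"
    using assms(11) unfolding nmcma_sequence_def Let_def by blast
  have cyc: "inner_cycle fs P (w k) (\<zeta> k) (wt k) (d k)"
    and step: "if f (wt k) \<le> reference_value f M w k - \<gamma> * max (\<zeta> k) (\<zeta> k * norm (d k)) then
             \<alpha> k = \<zeta> k \<and> \<zeta> (Suc k) = \<zeta> k
           else if norm (d k) \<le> \<tau> * \<zeta> k then
             \<alpha> k = 0 \<and> \<zeta> (Suc k) = \<theta> * \<zeta> k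
           else
             \<alpha> k = nmedfl f (reference_value f M w k) (w k) (d k) (\<zeta> k) \<gamma> \<delta> \<and>
             \<zeta> (Suc k) = (if (\<alpha> k)\<^sup>2 * (norm (d k))\<^sup>2 \<le> \<tau> * \<zeta> k then \<theta> * \<zeta> k else \<zeta> k)"
    and w_Suc: "w (Suc k) = w k + \<alpha> k *\<^sub>R d k" for k
    by (fact conjunct1[OF spec[OF run]] conjunct1[OF conjunct2[OF spec[OF run]]]
        conjunct2[OF conjunct2[OF spec[OF run]]])+
  let ?R = "reference_value f M w"
  have R: "f (w k) \<le> ?R k" for k using le_reference_value[of 0 k M f w] by simp
  have \<zeta>_cases: "\<zeta> (Suc k) = \<zeta> k \<or> \<zeta> (Suc k) = \<theta> * \<zeta> k" for k
    using step[of k] by (auto split: if_splits)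
  have \<zeta>_pos: "0 < \<zeta> k" for k
  proof (induction k)
    case (Suc k)
    then show ?case using \<zeta>_cases[of k] pos by auto
  qed (simp add: \<open>\<zeta> 0 = \<zeta>0\<close> \<open>\<zeta>0 > 0\<close>)
  have \<zeta>_dec: "\<zeta> (Suc k) \<le> \<zeta> k" for k using \<zeta>_cases[of k] \<zeta>_pos[of k] pos by auto
  have \<zeta>_le: "\<zeta> k \<le> \<zeta>0" for k
    using lift_Suc_antimono_le[of \<zeta>, OF \<zeta>_dec, of 0 k] \<open>\<zeta> 0 = \<zeta>0\<close> by simp
  \<comment> \<open>Rewriting \<open>wt k\<close> as the endpoint
    \<open>w k + \<zeta> k *\<^sub>R d k\<close> makes the case analysis applicable; folding the
    update turns its conclusions into statements about \<open>w (Suc k)\<close>.\<close>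
  note step_cases = nmcma_step_cases[OF bdd \<zeta>_pos pos(3-6) R
      step[unfolded inner_cycle_endpoint[OF cyc]], folded w_Suc,
      case_names progress small stalled]
  have mono: "f (w (Suc k)) \<le> ?R k" for k
  proof (cases rule: step_cases[of k])
    case progress
    moreover have "0 \<le> \<gamma> * min 1 \<tau> * \<zeta> k" using pos \<zeta>_pos[of k] by simp
    ultimately show ?thesis by linarith
  qed auto
  have in_level: "w k \<in> {u. f u \<le> f w0}" for k
  proof -
    \<comment> \<open>The first window contains only \<open>w0\<close>, so monotone reference values
      confine all iterates to its level set.\<close>
    have "?R 0 \<le> f w0" by (rule reference_value_leI) (simp add: \<open>w 0 = w0\<close>)
    moreover have "?R k \<le> ?R 0" by (rule reference_value_antimono[of f w M, OF mono]) simp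
    ultimately show ?thesis using R[of k] by simp
  qed

  have inf: "infinite {k. \<zeta> (Suc k) = \<theta> * \<zeta> k}"
  proof
    assume "finite {k. \<zeta> (Suc k) = \<theta> * \<zeta> k}"
    then obtain K where K: "\<And>k. K \<le> k \<Longrightarrow> \<zeta> (Suc k) \<noteq> \<theta> * \<zeta> k"
      by (auto simp: finite_nat_set_iff_bounded) (meson not_le)
    then have "\<zeta> (K + i) = \<zeta> K" for i
      using \<zeta>_cases by (induction i) (auto, metis le_add1)
    then have const: "\<zeta> k = \<zeta> K" if "K \<le> k" for k using that by (metis le_Suc_ex)
    have "f (w (Suc k)) \<le> ?R k - \<gamma> * min 1 \<tau> * \<zeta> K" if "K \<le> k" for k
      using K[OF that] const[OF that] by (cases rule: step_cases[of k]) auto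
    then have "\<gamma> * min 1 \<tau> * \<zeta> K \<le> 0"
      by (rule bounded_below_no_uniform_decrease[of m f w M, OF bdd mono])
    moreover have "0 < \<gamma> * min 1 \<tau> * \<zeta> K" using pos \<zeta>_pos[of K] by simp
    ultimately show False by simp
  qed
  have \<zeta>_lim: "\<zeta> \<longlonglongrightarrow> 0"
    using \<zeta>_pos \<zeta>_dec pos inf by (intro geometric_reduction_tendsto_zero[of \<zeta> \<theta>]) (auto intro: less_imp_le)

  \<comment> \<open>Bounding the sum of the component norms gives one constant for every component
    gradient and for \<open>g\<close>.\<close>
  obtain G where G: "\<And>x. x \<in> {u. f u \<le> f w0} \<Longrightarrow> norm (\<Sum>p=1..P. norm (gradient (fs p) x)) \<le> G"
  proof -
    have "continuous_on {u. f u \<le> f w0} (\<lambda>x. \<Sum>p=1..P. norm (gradient (fs p) x))"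
      by (intro continuous_on_sum continuous_on_norm continuous_on_subset[OF cont_fs]) auto
    then have "bounded ((\<lambda>x. \<Sum>p=1..P. norm (gradient (fs p) x)) ` {u. f u \<le> f w0})"
      using assms(3) compact_continuous_image compact_imp_bounded by blast
    then show ?thesis using that by (auto simp: bounded_iff)
  qed
  have "0 \<le> G" using G[OF in_level[of 0]] norm_ge_zero order_trans by blast
  have G_fs: "norm (gradient (fs p) (w k)) \<le> G" if "p \<in> {1..P}" for p k
  proof -
    have "norm (gradient (fs p) (w k)) \<le> (\<Sum>p=1..P. norm (gradient (fs p) (w k)))"
      using that by (intro member_le_sum) auto
    then show ?thesis using G[OF in_level[of k]] by simp
  qed
  have G_g: "norm (g (w k)) \<le> G" for k
    using G[OF in_level[of k]] norm_sum[of "\<lambda>p. gradient (fs p) (w k)" "{1..P}"]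
    unfolding g_def by simp
  define C where "C = (\<Sum>i=1..P. L * (real (i - 1) * G * (1 + L * \<zeta>0) ^ (i - 1)))"
  have err: "norm (d k + g (w k)) \<le> C * \<zeta> k" for k
    unfolding C_def g_def
    using inner_cycle_gradient_error[OF cyc _ \<zeta>_le _ lip G_fs \<open>0 \<le> G\<close>] \<zeta>_pos[of k] \<open>L > 0\<close>
    by (simp add: less_imp_le)
  have "0 \<le> C" using \<open>0 \<le> G\<close> \<open>L > 0\<close> \<open>\<zeta>0 > 0\<close> unfolding C_def by (intro sum_nonneg) auto
  \<comment> \<open>The stalled case leaves a term \<open>\<zeta> k * norm (d k)\<close>; it
    vanishes with the stepsize only if the directions are bounded uniformly.\<close>
  define D where "D = C * \<zeta>0 + G"
  have d_le: "norm (d k) \<le> D" for k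
  proof -
    have "norm (d k) \<le> norm (d k + g (w k)) + norm (g (w k))"
      using norm_triangle_ineq4[of "d k + g (w k)" "g (w k)"] by simp
    also have "\<dots> \<le> C * \<zeta>0 + G"
      using err[of k] G_g[of k] mult_left_mono[OF \<zeta>_le \<open>0 \<le> C\<close>, of k] by linarith
    finally show ?thesis by (simp add: D_def)
  qed
  \<comment> \<open>The summands cover the small case, the stalled case, and the final passage from
    \<open>d k\<close> to \<open>g (w k)\<close>. Adding them up avoids splitting the reduction
    steps by case.\<close>
  define B where
    "B = (\<lambda>z. \<tau> * z + (C * z + (\<Lambda> + \<gamma>) * max (z * D) (sqrt (\<tau> * z) / \<delta>)) + C * z)"
  have bound: "norm (g (w k)) \<le> B (\<zeta> k)" if "\<zeta> (Suc k) = \<theta> * \<zeta> k" for k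
  proof -
    have \<zeta>: "0 \<le> \<zeta> k" using \<zeta>_pos[of k] by simp
    have nn: "0 \<le> \<tau> * \<zeta> k" "0 \<le> C * \<zeta> k" "0 \<le> (\<Lambda> + \<gamma>) * max (\<zeta> k * D) (sqrt (\<tau> * \<zeta> k) / \<delta>)"
      using \<zeta> \<open>0 \<le> C\<close> \<open>0 \<le> \<Lambda>\<close> pos by (auto simp: le_max_iff_disj)
    have "norm (d k) \<le> \<tau> * \<zeta> k + (C * \<zeta> k + (\<Lambda> + \<gamma>) * max (\<zeta> k * D) (sqrt (\<tau> * \<zeta> k) / \<delta>))"
    proof (cases rule: step_cases[of k])
      case progress
      \<comment> \<open>An unchanged stepsize contradicts the reduction because
        \<open>\<theta> < 1\<close> and \<open>\<zeta> k\<close> is positive.\<close>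
      then show ?thesis using that pos \<zeta>_pos[of k] by simp
    next
      case small
      then show ?thesis using nn by linarith
    next
      case (stalled a b)
      have "norm (d k) \<le> C * \<zeta> k + (\<Lambda> + \<gamma>) * (b * norm (d k))"
        by (rule insufficient_decrease_direction_bound[OF deriv lip_g \<open>0 \<le> \<Lambda>\<close> err stalled(3,4,6)])
      moreover have "b * norm (d k) \<le> max (\<zeta> k * D) (sqrt (\<tau> * \<zeta> k) / \<delta>)"
        using stalled(5) mult_left_mono[OF d_le \<zeta>, of k] by linarith
      then have "(\<Lambda> + \<gamma>) * (b * norm (d k)) \<le> (\<Lambda> + \<gamma>) * max (\<zeta> k * D) (sqrt (\<tau> * \<zeta> k) / \<delta>)"
        using \<open>0 \<le> \<Lambda>\<close> pos by (intro mult_left_mono) simp_all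
      ultimately show ?thesis using nn by linarith
    qed
    moreover have "norm (g (w k)) \<le> norm (d k + g (w k)) + norm (d k)"
      using norm_triangle_ineq4[of "d k + g (w k)" "d k"] by simp
    ultimately show ?thesis using err[of k] unfolding B_def by linarith
  qed
  have "continuous_on UNIV B"
    unfolding B_def using pos by (intro continuous_intros) auto
  moreover have "B 0 = 0" by (simp add: B_def)
  ultimately have B_lim: "(\<lambda>k. B (\<zeta> k)) \<longlonglongrightarrow> 0"
    using continuous_on_tendsto_compose[of UNIV B \<zeta> 0 sequentially] \<zeta>_lim by simp

  define r where "r = enumerate {k. \<zeta> (Suc k) = \<theta> * \<zeta> k}"
  have r: "strict_mono r" unfolding r_def using inf by (rule strict_mono_enumerate)
  have r_red: "\<zeta> (Suc (r n)) = \<theta> * \<zeta> (r n)" for n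
    using enumerate_in_set[OF inf, of n] by (simp add: r_def)
  \<comment> \<open>Compactness is applied to the reduction iterates only, since the bound
    \<open>B\<close> on the gradient is available just there.\<close>
  obtain x s where s: "strict_mono s" and lim: "((w \<circ> r) \<circ> s) \<longlonglongrightarrow> x"
    using compact_imp_seq_compact[OF assms(3)[of w0]] in_level unfolding seq_compact_def
    by (metis comp_apply)
  have rs: "strict_mono (r \<circ> s)" using r s by (rule strict_mono_o)
  have limit_point: "seq_limit_point w x"
    unfolding seq_limit_point_def using rs lim by (metis comp_assoc)
  have "(\<lambda>n. g (w (r (s n)))) \<longlonglongrightarrow> g x"
    using continuous_on_tendsto_compose[OF cont_g lim] by (simp add: o_def)
  moreover have "(\<lambda>n. g (w (r (s n)))) \<longlonglongrightarrow> 0"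
  proof (rule Lim_null_comparison)
    show "\<forall>\<^sub>F n in sequentially. norm (g (w (r (s n)))) \<le> B (\<zeta> (r (s n)))"
      using bound r_red by simp
    show "(\<lambda>n. B (\<zeta> (r (s n)))) \<longlonglongrightarrow> 0"
      using LIMSEQ_subseq_LIMSEQ[OF B_lim rs] by (simp add: o_def)
  qed
  ultimately have "g x = 0" by (rule LIMSEQ_unique)
  then have "gradient f x = 0" using GDERIV_gradient[OF deriv] by metis
  with limit_point show ?thesis by blast
qed

end
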